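(* Let $\sigma\in\mathcal S_k$ and $\tau\in\mathcal S_\ell$ be incomparable patterns. Then $$\Pr(\sigma\prec\tau)=\sum_{n\ge k}\frac{|\mathrm{Av}_n^\sigma(\sigma,\tau)|}{n!}.$$
   Context: $\mathcal S_k$ is the set of permutations of $\{1,\dots,k\}$. For a sequence of distinct reals, $\mathrm{st}$ replaces the smallest entry by $1$, the second smallest by $2$, etc. A consecutive occurrence of $\sigma\in\mathcal S_k$ in a sequence or permutation is a block of $k$ adjacent entries whose standardization is $\sigma$. Two patterns are incomparable if neither contains a consecutive occurrence of the other. Let $X_1,X_2,\dots$ be i.i.d. continuous random variables (e.g. uniform on $[0,1]$), and let $T_\sigma$ be the smallest $j$ such that $X_1,\dots,X_j$ contains a consecutive occurrence of $\sigma$. $\Pr(\sigma\prec\tau)$ is the probability that $\sigma$ appears before $\tau$ in the random sequence, i.e. $\Pr(T_\sigma<T_\tau)$. $\mathrm{Av}_n^\sigma(\sigma,\tau)$ is the set of permutations in $\mathcal S_n$ that end with a consecutive occurrence of $\sigma$ (i.e. their last $k$ entries form one) and have no other consecutive occurrence of $\sigma$ or $\tau$. *)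

theory Defs
  imports "HOL-Probability.Probability" "HOL-Combinatorics.Multiset_Permutations"
begin

text \<open>Permutations are written in one-line notation, as lists over \<open>{1..k}\<close>
  without repetitions.\<close>

abbreviation Sym :: "nat \<Rightarrow> nat list set" where
  "Sym k \<equiv> permutations_of_set {1..k}"

text \<open>Intended for lists of distinct entries. If \<open>xs\<close> has a repeated entry then so does
  \<open>st xs\<close>, so that it is not a permutation; such blocks are never occurrences of a pattern.\<close>

definition st :: "'a::linorder list \<Rightarrow> nat list" where
  "st xs = map (\<lambda>x. card {y \<in> set xs. y \<le> x}) xs"

text \<open>The block starts after the first \<open>i\<close> entries of \<open>xs\<close>.\<close>

definition occurs_at :: "nat list \<Rightarrow> 'a::linorder list \<Rightarrow> nat \<Rightarrow> bool" where
  "occurs_at \<sigma> xs i \<longleftrightarrow>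
     i + length \<sigma> \<le> length xs \<and> st (take (length \<sigma>) (drop i xs)) = \<sigma>"

definition contains_pattern :: "nat list \<Rightarrow> 'a::linorder list \<Rightarrow> bool" where
  "contains_pattern \<sigma> xs \<longleftrightarrow> (\<exists>i. occurs_at \<sigma> xs i)"

definition incomparable :: "nat list \<Rightarrow> nat list \<Rightarrow> bool" where
  "incomparable \<sigma> \<tau> \<longleftrightarrow> \<not> contains_pattern \<sigma> \<tau> \<and> \<not> contains_pattern \<tau> \<sigma>"

text \<open>Sequences are indexed from 1; the entry \<open>x 0\<close> plays no role. The value is \<open>\<infinity>\<close>
  if the pattern never occurs.\<close>

definition first_time :: "nat list \<Rightarrow> (nat \<Rightarrow> real) \<Rightarrow> enat" where
  "first_time \<sigma> x = (INF j \<in> {j. contains_pattern \<sigma> (map x [1..<Suc j])}. enat j)"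

text \<open>The set \<open>Av\<^sub>n\<^sup>\<sigma>(\<sigma>, \<tau>)\<close>.\<close>

definition Av_end :: "nat \<Rightarrow> nat list \<Rightarrow> nat list \<Rightarrow> nat list set" where
  "Av_end n \<sigma> \<tau> = {\<pi> \<in> Sym n. occurs_at \<sigma> \<pi> (n - length \<sigma>) \<and>
     (\<forall>\<rho>\<in>{\<sigma>, \<tau>}. \<forall>i. occurs_at \<rho> \<pi> i \<longrightarrow> \<rho> = \<sigma> \<and> i = n - length \<sigma>)}"

definition prob_before :: "'a measure \<Rightarrow> (nat \<Rightarrow> 'a \<Rightarrow> real) \<Rightarrow> nat list \<Rightarrow> nat list \<Rightarrow> real" where
  "prob_before M X \<sigma> \<tau> =
     measure M {\<omega> \<in> space M. first_time \<sigma> (\<lambda>i. X i \<omega>) < first_time \<tau> (\<lambda>i. X i \<omega>)}"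

end

theory Submission
  imports Defs
begin

text \<open>
  The event that \<open>\<sigma>\<close> appears before \<open>\<tau>\<close> splits according to the value \<open>n\<close> of \<open>T\<^sub>\<sigma>\<close>. One has
  \<open>T\<^sub>\<sigma> = n < T\<^sub>\<tau>\<close> exactly if the word \<open>X\<^sub>1 \<dots> X\<^sub>n\<close> ends with an occurrence of \<open>\<sigma>\<close> and contains no
  other occurrence of either pattern (\<open>first_hit_prefix_iff_first_time\<close>). Whether a word has this
  property depends only on its standardization, because standardizing the whole word does not
  change the standardization of its blocks (\<open>st_take_drop_st\<close>). So, up to a null set on which two
  of the values coincide, the event for \<open>n\<close> says that the standardization of \<open>X\<^sub>1 \<dots> X\<^sub>n\<close> lies in
  \<open>Av\<^sub>n\<^sup>\<sigma>(\<sigma>, \<tau>)\<close>.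

  It remains to see that this standardization is uniformly distributed on the permutations of
  \<open>{1..n}\<close> (\<open>prob_st_eq\<close>). Fix a permutation \<open>\<pi>\<close>. Among the \<open>n!\<close> rearrangements of a word of
  distinct entries exactly one standardizes to \<open>\<pi>\<close> (\<open>card_arrangements_st\<close>), so the probabilities
  that the various rearrangements of \<open>X\<^sub>1 \<dots> X\<^sub>n\<close> standardize to \<open>\<pi>\<close> add up to \<open>1\<close>; and these
  \<open>n!\<close> probabilities are equal because independent, identically distributed variables are
  exchangeable (\<open>prob_st_rearrange\<close>).
\<close>

section \<open>Standardization\<close>

lemma length_st [simp]: "length (st xs) = length xs"
  by (simp add: st_def)

lemma st_map_strict_mono_on:
  fixes f :: "'a::linorder \<Rightarrow> 'b::linorder"
  assumes "strict_mono_on (set xs) f"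
  shows "st (map f xs) = st xs"
proof -
  have "card {y \<in> f ` set xs. y \<le> f x} = card {y \<in> set xs. y \<le> x}" if "x \<in> set xs" for x
  proof -
    have "{y \<in> f ` set xs. y \<le> f x} = f ` {y \<in> set xs. y \<le> x}"
      using strict_mono_on_less_eq[OF assms] that by blast
    moreover have "inj_on f {y \<in> set xs. y \<le> x}"
      using strict_mono_on_imp_inj_on[OF assms] by (rule inj_on_subset) auto
    ultimately show ?thesis
      by (simp add: card_image)
  qed
  then show ?thesis
    by (simp add: st_def)
qed

text \<open>Standardization replaces every entry by its rank, so that by this monotonicity it is itself
  an instance of \<open>st_map_strict_mono_on\<close>.\<close>

lemma strict_mono_on_rank:
  fixes A :: "'a::linorder set"
  assumes "finite A"
  shows "strict_mono_on A (\<lambda>x. card {y \<in> A. y \<le> x})"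
proof (rule strict_mono_onI)
  fix x x' assume "x \<in> A" "x' \<in> A" "x < x'"
  then have "{y \<in> A. y \<le> x} \<subset> {y \<in> A. y \<le> x'}"
    by force
  then show "card {y \<in> A. y \<le> x} < card {y \<in> A. y \<le> x'}"
    using assms by (intro psubset_card_mono) auto
qed

text \<open>Patterns in a sequence can be read off its standardization, since the ranks within the
  whole sequence order the entries of a block as their values do. Ties are harmless, as
  equal entries have equal ranks.\<close>

lemma st_take_drop_st: "st (take m (drop i (st xs))) = st (take m (drop i xs))"
proof -
  let ?ys = "take m (drop i xs)"
  let ?r = "\<lambda>x. card {y \<in> set xs. y \<le> x}"
  have "set ?ys \<subseteq> set xs"
    by (meson order_trans set_drop_subset set_take_subset)
  then have "strict_mono_on (set ?ys) ?r"
    by (rule monotone_on_subset[OF strict_mono_on_rank[OF finite_set]])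
  from st_map_strict_mono_on[OF this] show ?thesis
    by (simp add: st_def[of xs] take_map drop_map)
qed

lemma occurs_at_st: "occurs_at \<rho> (st xs) i \<longleftrightarrow> occurs_at \<rho> xs i"
  by (simp add: occurs_at_def st_take_drop_st)

lemma st_in_Sym:
  assumes "distinct xs"
  shows "st xs \<in> Sym (length xs)"
proof
  show d: "distinct (st xs)"
    using strict_mono_on_imp_inj_on[OF strict_mono_on_rank[OF finite_set[of xs]]] assms
    by (simp add: st_def distinct_map)
  have "set (st xs) \<subseteq> {1..length xs}"
  proof
    fix m assume "m \<in> set (st xs)"
    then obtain x where x: "x \<in> set xs" "m = card {y \<in> set xs. y \<le> x}"
      by (auto simp: st_def)
    have "m > 0"
      using x by (auto simp: card_gt_0_iff)
    moreover have "m \<le> card (set xs)"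
      unfolding x by (intro card_mono) auto
    moreover have "card (set xs) \<le> length xs"
      by (rule card_length)
    ultimately show "m \<in> {1..length xs}"
      by simp
  qed
  then show "set (st xs) = {1..length xs}"
    using distinct_card[OF d] by (intro card_subset_eq) auto
qed

lemma st_Sym:
  assumes "\<pi> \<in> Sym n"
  shows "st \<pi> = \<pi>"
proof -
  have "{y \<in> {1..n}. y \<le> x} = {1..x}" if "x \<le> n" for x
    using that by auto
  then show ?thesis
    using permutations_of_setD(1)[OF assms] by (auto simp: st_def intro!: map_idI)
qed

text \<open>Every rearrangement of the family \<open>x\<close> has the same set of values, so standardizing it
  means applying one fixed rank function \<open>r\<close> to the indices. As \<open>r\<close> is injective, it induces an
  injection from the arrangements of \<open>A\<close> to the permutations of \<open>{1..card A}\<close>. The two sets have the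
  same size, so it is a bijection.\<close>

lemma card_arrangements_st:
  fixes x :: "'i \<Rightarrow> 'a::linorder"
  assumes "finite A" and inj: "inj_on x A" and \<pi>: "\<pi> \<in> Sym (card A)"
  shows "card {p \<in> permutations_of_set A. st (map x p) = \<pi>} = 1"
proof -
  define r where "r i = card {y \<in> x ` A. y \<le> x i}" for i
  have st_eq: "st (map x p) = map r p" if "p \<in> permutations_of_set A" for p
    using permutations_of_setD(1)[OF that] by (simp add: st_def r_def)
  have "strict_mono_on (x ` A) (\<lambda>z. card {y \<in> x ` A. y \<le> z})"
    using assms by (intro strict_mono_on_rank) auto
  then have "inj_on ((\<lambda>z. card {y \<in> x ` A. y \<le> z}) \<circ> x) A"
    by (intro comp_inj_on inj strict_mono_on_imp_inj_on)
  then have inj_r: "inj_on r A"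
    by (simp add: r_def[abs_def] comp_def)
  have inj_map: "inj_on (map r) (permutations_of_set A)"
    using inj_r by (intro inj_onI) (auto dest!: permutations_of_setD(1) intro: map_inj_on)
  have "map r p \<in> Sym (card A)" if "p \<in> permutations_of_set A" for p
    using st_in_Sym[of "map x p"] st_eq[OF that] inj permutations_of_setD[OF that]
    by (simp add: distinct_map length_finite_permutations_of_set[OF that])
  then have "map r ` permutations_of_set A \<subseteq> Sym (card A)"
    by blast
  then have "map r ` permutations_of_set A = Sym (card A)"
    using assms by (intro card_subset_eq) (auto simp: card_image[OF inj_map])
  with \<pi> have "\<pi> \<in> map r ` permutations_of_set A"
    by simp
  then obtain p where p: "p \<in> permutations_of_set A" "map r p = \<pi>"
    by auto
  have "{q \<in> permutations_of_set A. st (map x q) = \<pi>} = {p}"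
  proof (intro equalityI subsetI)
    fix q assume "q \<in> {q \<in> permutations_of_set A. st (map x q) = \<pi>}"
    then have "q \<in> permutations_of_set A" "map r q = map r p"
      using p by (auto simp: st_eq)
    then show "q \<in> {p}"
      using inj_onD[OF inj_map] p(1) by blast
  qed (use p in \<open>simp add: st_eq\<close>)
  then show ?thesis
    by simp
qed

section \<open>The first occurrence of a pattern\<close>

text \<open>The condition defining \<open>Av_end\<close>, for words over any linear order, so that it applies both to
  the random word and to its standardization.\<close>

definition first_hit :: "nat list \<Rightarrow> nat list \<Rightarrow> 'a::linorder list \<Rightarrow> bool" where
  "first_hit \<sigma> \<tau> xs \<longleftrightarrow>
     occurs_at \<sigma> xs (length xs - length \<sigma>) \<and>
     (\<forall>\<rho>\<in>{\<sigma>, \<tau>}. \<forall>i. occurs_at \<rho> xs i \<longrightarrow> \<rho> = \<sigma> \<and> i = length xs - length \<sigma>)"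

lemma first_hit_st: "first_hit \<sigma> \<tau> (st xs) \<longleftrightarrow> first_hit \<sigma> \<tau> xs"
  by (simp add: first_hit_def occurs_at_st)

lemma Av_end_eq_first_hit:
  "Av_end n \<sigma> \<tau> = {\<pi> \<in> Sym n. first_hit \<sigma> \<tau> \<pi>}"
proof -
  have "length \<pi> = n" if "\<pi> \<in> Sym n" for \<pi>
    using length_finite_permutations_of_set[OF that] by simp
  then show ?thesis
    unfolding Av_end_def first_hit_def by (intro Collect_cong) (metis (no_types, lifting))
qed

lemma occurs_at_take:
  "occurs_at \<rho> (take m xs) i \<longleftrightarrow> i + length \<rho> \<le> m \<and> occurs_at \<rho> xs i"
  by (auto simp: occurs_at_def drop_take min_def)

text \<open>An occurrence of \<open>\<sigma>\<close> in a proper prefix is an occurrence that does not end at the end of the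
  word. That the patterns differ is what makes \<open>first_hit\<close> forbid \<open>\<tau>\<close> altogether.\<close>

lemma first_hit_iff:
  assumes "\<sigma> \<noteq> \<tau>"
  shows "first_hit \<sigma> \<tau> xs \<longleftrightarrow> contains_pattern \<sigma> xs \<and> \<not> contains_pattern \<tau> xs \<and>
           (\<forall>m<length xs. \<not> contains_pattern \<sigma> (take m xs))"
    (is "?L \<longleftrightarrow> ?R")
proof
  assume L: ?L
  have "\<not> contains_pattern \<sigma> (take m xs)" if "m < length xs" for m
  proof
    assume "contains_pattern \<sigma> (take m xs)"
    then obtain i where i: "i + length \<sigma> \<le> m" "occurs_at \<sigma> xs i"
      unfolding contains_pattern_def occurs_at_take by blast
    then have "i = length xs - length \<sigma>"
      using L unfolding first_hit_def by blast
    with i(1) that show False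
      by linarith
  qed
  moreover have "contains_pattern \<sigma> xs" "\<not> contains_pattern \<tau> xs"
    using L assms unfolding first_hit_def contains_pattern_def by blast+
  ultimately show ?R
    by blast
next
  assume R: ?R
  have last: "i = length xs - length \<sigma>" if "occurs_at \<sigma> xs i" for i
  proof -
    have le: "i + length \<sigma> \<le> length xs"
      using that by (simp add: occurs_at_def)
    have "contains_pattern \<sigma> (take (i + length \<sigma>) xs)"
      using that by (auto simp: contains_pattern_def occurs_at_take)
    with R le have "\<not> i + length \<sigma> < length xs"
      by blast
    with le show ?thesis
      by simp
  qed
  obtain i where i: "occurs_at \<sigma> xs i"
    using R by (auto simp: contains_pattern_def)
  then have "occurs_at \<sigma> xs (length xs - length \<sigma>)"
    using last[OF i] by simp
  moreover have "\<not> occurs_at \<tau> xs j" for j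
    using R by (simp add: contains_pattern_def)
  ultimately show ?L
    using last unfolding first_hit_def by blast
qed

lemma first_time_le_iff:
  "first_time \<sigma> x \<le> enat n \<longleftrightarrow> contains_pattern \<sigma> (map x [1..<Suc n])"
proof
  let ?J = "{j. contains_pattern \<sigma> (map x [1..<Suc j])}"
  assume le: "first_time \<sigma> x \<le> enat n"
  have ne: "enat ` ?J \<noteq> {}"
  proof
    assume "enat ` ?J = {}"
    then have "first_time \<sigma> x = \<infinity>"
      unfolding first_time_def by (simp only: Inf_empty top_enat_def)
    with le show False
      by simp
  qed
  then have "first_time \<sigma> x \<in> enat ` ?J"
    unfolding first_time_def by (meson equals0I wellorder_InfI)
  then obtain j where j: "contains_pattern \<sigma> (map x [1..<Suc j])" "first_time \<sigma> x = enat j"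
    by blast
  with le have "take j (map x [1..<Suc n]) = map x [1..<Suc j]"
    by (simp add: take_map del: upt_Suc)
  with j(1) show "contains_pattern \<sigma> (map x [1..<Suc n])"
    by (metis contains_pattern_def occurs_at_take)
next
  assume "contains_pattern \<sigma> (map x [1..<Suc n])"
  then show "first_time \<sigma> x \<le> enat n"
    unfolding first_time_def by (intro INF_lower) simp
qed

lemma first_hit_prefix_iff_first_time:
  assumes "\<sigma> \<noteq> \<tau>"
  shows "first_hit \<sigma> \<tau> (map x [1..<Suc n]) \<longleftrightarrow> first_time \<sigma> x = enat n \<and> enat n < first_time \<tau> x"
proof -
  have "take m (map x [1..<Suc n]) = map x [1..<Suc m]" if "m < n" for m
    using that by (simp add: take_map del: upt_Suc)
  then have "first_hit \<sigma> \<tau> (map x [1..<Suc n]) \<longleftrightarrow>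
      first_time \<sigma> x \<le> enat n \<and> \<not> first_time \<tau> x \<le> enat n \<and>
      (\<forall>m<n. \<not> first_time \<sigma> x \<le> enat m)"
    unfolding first_hit_iff[OF assms] first_time_le_iff by (simp del: upt_Suc)
  also have "\<dots> \<longleftrightarrow> first_time \<sigma> x = enat n \<and> enat n < first_time \<tau> x"
    by (cases "first_time \<sigma> x") (auto simp: not_le le_less)
  finally show ?thesis .
qed

lemma first_time_less_iff:
  assumes "\<sigma> \<noteq> \<tau>"
  shows "first_time \<sigma> x < first_time \<tau> x \<longleftrightarrow> (\<exists>n. first_hit \<sigma> \<tau> (map x [1..<Suc n]))"
  unfolding first_hit_prefix_iff_first_time[OF assms] by (cases "first_time \<sigma> x") auto

section \<open>Independent variables with a common continuous law\<close>

text \<open>The rank of \<open>Z\<close> is a count of distinct values. It is built up one variable at a time: a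
  variable adds to the count if its value is at most \<open>Z\<close> and is not taken by a later variable of
  the list.\<close>

lemma measurable_st [measurable (raw)]:
  fixes Y :: "'i \<Rightarrow> 'a \<Rightarrow> real"
  assumes Y: "\<And>i. i \<in> set ks \<Longrightarrow> Y i \<in> borel_measurable M"
  shows "(\<lambda>\<omega>. st (map (\<lambda>i. Y i \<omega>) ks)) \<in> measurable M (count_space UNIV)"
proof -
  have rank: "(\<lambda>\<omega>. card {y \<in> set (map (\<lambda>i. Y i \<omega>) js). y \<le> Z \<omega>}) \<in> measurable M (count_space UNIV)"
    if "set js \<subseteq> set ks" and Z[measurable]: "Z \<in> borel_measurable M" for js Z
    using that(1)
  proof (induction js)
    case (Cons j js)
    have [measurable]: "Y j \<in> borel_measurable M"
      using Cons.prems Y by simp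
    have [measurable]: "Measurable.pred M (\<lambda>\<omega>. Y j \<omega> \<in> set (map (\<lambda>i. Y i \<omega>) js))"
    proof -
      have "Measurable.pred M (\<lambda>\<omega>. \<exists>i\<in>set js. Y j \<omega> = Y i \<omega>)"
        using Cons.prems Y by (intro pred_intros_finite) (auto intro!: borel_measurable_eq)
      then show ?thesis
        by (simp add: image_iff)
    qed
    have [measurable]: "(\<lambda>\<omega>. card {y \<in> set (map (\<lambda>i. Y i \<omega>) js). y \<le> Z \<omega>}) \<in> measurable M (count_space UNIV)"
      using Cons by simp
    have "card {y \<in> set (map (\<lambda>i. Y i \<omega>) (j # js)). y \<le> Z \<omega>} =
        (if Y j \<omega> \<le> Z \<omega> \<and> Y j \<omega> \<notin> set (map (\<lambda>i. Y i \<omega>) js) then 1 else 0) +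
        card {y \<in> set (map (\<lambda>i. Y i \<omega>) js). y \<le> Z \<omega>}" for \<omega>
    proof -
      let ?S = "{y \<in> set (map (\<lambda>i. Y i \<omega>) js). y \<le> Z \<omega>}"
      have "{y \<in> set (map (\<lambda>i. Y i \<omega>) (j # js)). y \<le> Z \<omega>} =
          (if Y j \<omega> \<le> Z \<omega> then insert (Y j \<omega>) ?S else ?S)"
        by auto
      then show ?thesis
        by (auto simp: card_insert_if)
    qed
    then show ?case
      by (simp only:) measurable
  qed simp
  have pred: "Measurable.pred M (\<lambda>\<omega>. st (map (\<lambda>i. Y i \<omega>) ks) = \<pi>)" for \<pi>
  proof -
    let ?Q = "\<lambda>m \<omega>. card {y \<in> set (map (\<lambda>i. Y i \<omega>) ks). y \<le> Y (ks ! m) \<omega>} = \<pi> ! m"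
    have "Measurable.pred M (?Q m)" if "m < length ks" for m
      using rank[OF subset_refl Y[OF nth_mem[OF that]]] by (rule pred_count_space_const1)
    then have "Measurable.pred M (\<lambda>\<omega>. length ks = length \<pi> \<and> (\<forall>m\<in>{..<length ks}. ?Q m \<omega>))"
      by (intro pred_intros_logic pred_intros_finite) auto
    also have "(\<lambda>\<omega>. length ks = length \<pi> \<and> (\<forall>m\<in>{..<length ks}. ?Q m \<omega>)) =
        (\<lambda>\<omega>. st (map (\<lambda>i. Y i \<omega>) ks) = \<pi>)"
      by (auto simp: st_def list_eq_iff_nth_eq fun_eq_iff)
    finally show ?thesis .
  qed
  have "(\<lambda>\<omega>. st (map (\<lambda>i. Y i \<omega>) ks)) -` {\<pi>} \<inter> space M \<in> sets M" for \<pi>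
    using pred[of \<pi>] by (simp add: pred_def vimage_def Int_def conj_commute)
  then show ?thesis
    by (simp add: measurable_count_space_eq2_countable)
qed

text \<open>The continuity of the common law \<open>D\<close> enters as the absence of atoms.\<close>

locale iid_continuous = prob_space M for M :: "'a measure" +
  fixes X :: "'i \<Rightarrow> 'a \<Rightarrow> real" and I :: "'i set" and D :: "real measure"
  assumes nonempty: "I \<noteq> {}"
    and indep: "indep_vars (\<lambda>_. borel) X I"
    and law: "\<And>i. i \<in> I \<Longrightarrow> distr M borel (X i) = D"
    and no_atoms: "\<And>x. emeasure D {x} = 0"
begin

lemma random_variable_X: "i \<in> I \<Longrightarrow> X i \<in> borel_measurable M"
  using indep by (simp add: indep_vars_def)

lemma law_pair:
  assumes ij: "i \<in> I" "j \<in> I" "i \<noteq> j"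
  shows "distr M (borel \<Otimes>\<^sub>M borel) (\<lambda>\<omega>. (X i \<omega>, X j \<omega>)) = D \<Otimes>\<^sub>M D"
proof -
  have "indep_var
    borel ((\<lambda>f. f i) \<circ> (\<lambda>\<omega>. restrict (\<lambda>i. X i \<omega>) {i}))
    borel ((\<lambda>f. f j) \<circ> (\<lambda>\<omega>. restrict (\<lambda>i. X i \<omega>) {j}))"
    using ij by (intro indep_var_compose[OF indep_var_restrict[OF indep]]) auto
  then have "indep_var borel (X i) borel (X j)"
    by (simp add: comp_def)
  then show ?thesis
    using law ij by (simp add: indep_var_distribution_eq)
qed

text \<open>By Fubini, the diagonal has measure zero in the square of a law without atoms.\<close>

lemma AE_neq:
  assumes ij: "i \<in> I" "j \<in> I" "i \<noteq> j"
  shows "AE \<omega> in M. X i \<omega> \<noteq> X j \<omega>"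
proof -
  note [measurable] = random_variable_X[OF ij(1)] random_variable_X[OF ij(2)]
  have sets_D[measurable_cong]: "sets D = sets borel"
    using law[OF ij(1)] by auto
  have "prob_space D"
    using prob_space_distr[OF random_variable_X[OF ij(1)]] law[OF ij(1)] by simp
  then interpret D: prob_space D .
  have diag: "{z. fst z = snd z} \<in> sets (D \<Otimes>\<^sub>M D)"
  proof -
    have "{z \<in> space (D \<Otimes>\<^sub>M D). fst z = snd z} \<in> sets (D \<Otimes>\<^sub>M D)"
      by measurable
    then show ?thesis
      using sets_eq_imp_space_eq[OF sets_D] by (simp add: space_pair_measure)
  qed
  have "emeasure (D \<Otimes>\<^sub>M D) {z. fst z = snd z} = (\<integral>\<^sup>+x. emeasure D {x} \<partial>D)"
    unfolding D.emeasure_pair_measure_alt[OF diag] by (simp add: vimage_def)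
  also have "\<dots> = 0"
    by (simp add: no_atoms)
  finally have "emeasure (D \<Otimes>\<^sub>M D) {z. fst z = snd z} = 0" .
  then have "AE z in D \<Otimes>\<^sub>M D. fst z \<noteq> snd z"
    using diag by (intro AE_I[where N = "{z. fst z = snd z}"]) auto
  then show ?thesis
    unfolding law_pair[OF ij, symmetric] by (subst (asm) AE_distr_iff) auto
qed

lemma AE_distinct:
  assumes "distinct ks" "set ks \<subseteq> I"
  shows "AE \<omega> in M. distinct (map (\<lambda>i. X i \<omega>) ks)"
proof -
  have "AE \<omega> in M. \<forall>i\<in>set ks. \<forall>j\<in>set ks. i \<noteq> j \<longrightarrow> X i \<omega> \<noteq> X j \<omega>"
    using assms AE_neq by (intro AE_finite_allI) (auto simp: subset_iff)
  then show ?thesis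
    by eventually_elim (use assms in \<open>auto simp: distinct_map inj_on_def\<close>)
qed

text \<open>The right-hand side depends on the list of indices only through its length: this is
  exchangeability.\<close>

lemma law_list:
  assumes "distinct ks" "set ks \<subseteq> I"
  shows "distr M (\<Pi>\<^sub>M m\<in>{..<length ks}. borel) (\<lambda>\<omega>. \<lambda>m\<in>{..<length ks}. X (ks ! m) \<omega>) =
    (\<Pi>\<^sub>M m\<in>{..<length ks}. D)"
proof -
  let ?J = "{..<length ks}"
  have is_I: "ks ! m \<in> I" if "m < length ks" for m
    using assms that by auto
  have sets_D: "sets D = sets borel" and "prob_space D"
    using law prob_space_distr[OF random_variable_X] nonempty by force+
  have joint: "distr M (\<Pi>\<^sub>M i\<in>I. borel) (\<lambda>\<omega>. \<lambda>i\<in>I. X i \<omega>) = (\<Pi>\<^sub>M i\<in>I. D)"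
    using indep_vars_iff_distr_eq_PiM'[OF nonempty, of X "\<lambda>_. borel"] indep random_variable_X law
    by (simp cong: PiM_cong)
  have select: "(\<lambda>y. \<lambda>m\<in>?J. y (ks ! m)) \<in> measurable (\<Pi>\<^sub>M i\<in>I. borel) (\<Pi>\<^sub>M m\<in>?J. (borel :: real measure))"
    using is_I by (intro measurable_restrict measurable_component_singleton) auto
  have "distr M (\<Pi>\<^sub>M m\<in>?J. borel) (\<lambda>\<omega>. \<lambda>m\<in>?J. X (ks ! m) \<omega>) =
      distr M (\<Pi>\<^sub>M m\<in>?J. borel) ((\<lambda>y. \<lambda>m\<in>?J. y (ks ! m)) \<circ> (\<lambda>\<omega>. \<lambda>i\<in>I. X i \<omega>))"
    using is_I by (intro distr_cong) (auto simp: fun_eq_iff restrict_def)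
  also have "\<dots> = distr (\<Pi>\<^sub>M i\<in>I. D) (\<Pi>\<^sub>M m\<in>?J. borel) (\<lambda>y. \<lambda>m\<in>?J. y (ks ! m))"
    unfolding joint[symmetric] by (intro distr_distr[symmetric] select measurable_restrict random_variable_X)
  also have "\<dots> = distr (\<Pi>\<^sub>M i\<in>I. D) (\<Pi>\<^sub>M m\<in>?J. D) (\<lambda>y. \<lambda>m\<in>?J. y (ks ! m))"
    using sets_D by (intro distr_cong) (auto intro!: sets_PiM_cong)
  also have "\<dots> = (\<Pi>\<^sub>M m\<in>?J. D)"
    using assms \<open>prob_space D\<close> is_I
    by (intro distr_PiM_reindex) (auto simp: inj_on_def nth_eq_iff_index_eq)
  finally show ?thesis .
qed

lemma st_in_events:
  assumes "set ks \<subseteq> I"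
  shows "{\<omega> \<in> space M. P (st (map (\<lambda>i. X i \<omega>) ks))} \<in> events"
proof -
  have "(\<lambda>\<omega>. st (map (\<lambda>i. X i \<omega>) ks)) \<in> measurable M (count_space UNIV)"
    using assms by (intro measurable_st random_variable_X) auto
  then show ?thesis
    by measurable
qed

lemma prob_st_rearrange:
  assumes "distinct p" "distinct q" "length p = length q" "set p \<subseteq> I" "set q \<subseteq> I"
  shows "prob {\<omega> \<in> space M. st (map (\<lambda>i. X i \<omega>) p) = \<pi>} =
    prob {\<omega> \<in> space M. st (map (\<lambda>i. X i \<omega>) q) = \<pi>}"
proof -
  let ?N = "\<Pi>\<^sub>M m\<in>{..<length q}. (borel :: real measure)"
  let ?S = "{y \<in> space ?N. st (map y [0..<length q]) = \<pi>}"
  have "(\<lambda>y. st (map (\<lambda>m. y m) [0..<length q])) \<in> measurable ?N (count_space UNIV)"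
    by (intro measurable_st measurable_component_singleton) auto
  then have S: "?S \<in> sets ?N"
    by measurable
  have "prob {\<omega> \<in> space M. st (map (\<lambda>i. X i \<omega>) ks) = \<pi>} = measure (\<Pi>\<^sub>M m\<in>{..<length q}. D) ?S"
    if "distinct ks" "set ks \<subseteq> I" and len: "length ks = length q" for ks
  proof -
    let ?F = "\<lambda>\<omega>. \<lambda>m\<in>{..<length q}. X (ks ! m) \<omega>"
    have F: "?F \<in> measurable M ?N"
      using that by (intro measurable_restrict random_variable_X) auto
    have map_F: "map (?F \<omega>) [0..<length q] = map (\<lambda>i. X i \<omega>) ks" for \<omega>
      using len by (intro nth_equalityI) simp_all
    have "{\<omega> \<in> space M. st (map (\<lambda>i. X i \<omega>) ks) = \<pi>} = ?F -` ?S \<inter> space M"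
      using measurable_space[OF F] by (auto simp only: map_F vimage_def Int_def mem_Collect_eq)
    also have "prob \<dots> = measure (distr M ?N ?F) ?S"
      by (rule measure_distr[OF F S, symmetric])
    also have "distr M ?N ?F = (\<Pi>\<^sub>M m\<in>{..<length q}. D)"
      using law_list[OF that(1,2)] unfolding len .
    finally show ?thesis .
  qed
  from this[of p] this[of q] assms show ?thesis
    by simp
qed

text \<open>The expected number of rearrangements of the variables that standardize to \<open>\<pi>\<close> is \<open>1\<close>, since
  that number is almost surely \<open>1\<close>. It is also a sum of \<open>n!\<close> equal probabilities.\<close>

lemma prob_st_eq:
  assumes "distinct ks" "set ks \<subseteq> I" and \<pi>: "\<pi> \<in> Sym (length ks)"
  shows "prob {\<omega> \<in> space M. st (map (\<lambda>i. X i \<omega>) ks) = \<pi>} = 1 / fact (length ks)"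
proof -
  let ?E = "\<lambda>p. {\<omega> \<in> space M. st (map (\<lambda>i. X i \<omega>) p) = \<pi>}"
  let ?P = "permutations_of_set (set ks)"
  have E: "?E p \<in> events" if "p \<in> ?P" for p
    using st_in_events[of p "\<lambda>s. s = \<pi>"] permutations_of_setD(1)[OF that] assms by simp
  have card_is: "card (set ks) = length ks"
    using assms by (simp add: distinct_card)
  have one: "AE \<omega> in M. (\<Sum>p\<in>?P. indicator (?E p) \<omega>) = (1::real)"
    using AE_distinct[OF assms(1,2)] AE_space
  proof eventually_elim
    case (elim \<omega>)
    have "(\<Sum>p\<in>?P. indicator (?E p) \<omega>) = (\<Sum>p\<in>?P. if st (map (\<lambda>i. X i \<omega>) p) = \<pi> then 1 else (0::real))"
      using elim by (intro sum.cong) (auto simp: indicator_def)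
    also have "\<dots> = real (card {p \<in> ?P. st (map (\<lambda>i. X i \<omega>) p) = \<pi>})"
      by (simp add: sum.If_cases Int_def)
    also have "\<dots> = 1"
      using elim \<pi> by (subst card_arrangements_st) (auto simp: distinct_map card_is)
    finally show ?case .
  qed
  have "fact (length ks) * prob (?E ks) = (\<Sum>p\<in>?P. prob (?E ks))"
    by (simp add: card_is)
  also have "\<dots> = (\<Sum>p\<in>?P. prob (?E p))"
    using assms
    by (intro sum.cong refl prob_st_rearrange)
      (auto simp: card_is length_finite_permutations_of_set dest: permutations_of_setD)
  also have "\<dots> = (\<Sum>p\<in>?P. expectation (indicator (?E p)))"
    using E by (intro sum.cong refl) (simp add: Int_absorb2 sets.sets_into_space)
  also have "\<dots> = expectation (\<lambda>\<omega>. \<Sum>p\<in>?P. indicator (?E p) \<omega>)"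
    using E by (intro Bochner_Integration.integral_sum[symmetric] integrable_real_indicator)
      (auto simp: emeasure_eq_measure)
  also have "\<dots> = expectation (\<lambda>_. 1)"
    using one E by (intro integral_cong_AE borel_measurable_sum borel_measurable_indicator) auto
  finally show ?thesis
    by (simp add: field_simps prob_space)
qed

lemma prob_st_in:
  assumes ks: "distinct ks" "set ks \<subseteq> I" and A: "A \<subseteq> Sym (length ks)"
  shows "prob {\<omega> \<in> space M. st (map (\<lambda>i. X i \<omega>) ks) \<in> A} = real (card A) / fact (length ks)"
proof -
  let ?E = "\<lambda>\<pi>. {\<omega> \<in> space M. st (map (\<lambda>i. X i \<omega>) ks) = \<pi>}"
  have fin: "finite A"
    using A by (rule finite_subset) simp
  have "prob {\<omega> \<in> space M. st (map (\<lambda>i. X i \<omega>) ks) \<in> A} = prob (\<Union>\<pi>\<in>A. ?E \<pi>)"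
    by (rule arg_cong[where f = prob]) auto
  also have "\<dots> = (\<Sum>\<pi>\<in>A. prob (?E \<pi>))"
    using fin st_in_events[OF ks(2)]
    by (intro finite_measure_finite_Union) (auto simp: disjoint_family_on_def)
  also have "\<dots> = (\<Sum>\<pi>\<in>A. 1 / fact (length ks))"
    using A by (intro sum.cong refl prob_st_eq ks) auto
  finally show ?thesis
    by simp
qed

end

section \<open>The race between two patterns\<close>

theorem theorem3p7:
  fixes M :: "'a measure" and X :: "nat \<Rightarrow> 'a \<Rightarrow> real"
    and \<sigma> \<tau> :: "nat list" and k l :: nat
  assumes "prob_space M"
    and "prob_space.indep_vars M (\<lambda>_. borel) X {1..}"
    and "\<And>i. i \<ge> 1 \<Longrightarrow> distr M borel (X i) = distr M borel (X 1)"
    and "continuous_on UNIV (cdf (distr M borel (X 1)))"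
    and "\<sigma> \<in> Sym k" and "\<tau> \<in> Sym l"
    and "incomparable \<sigma> \<tau>"
  shows "((\<lambda>n. real (card (Av_end n \<sigma> \<tau>)) / fact n) has_sum prob_before M X \<sigma> \<tau>) {k..}"
proof -
  let ?D = "distr M borel (X 1)"
  interpret prob_space M by fact
  have "X 1 \<in> borel_measurable M"
    using assms(2) by (simp add: indep_vars_def)
  then interpret D: real_distribution ?D
    by (rule real_distribution_distr)
  have "isCont (cdf ?D) x" for x
    using assms(4) by (simp add: continuous_on_eq_continuous_at)
  then have atomless: "emeasure ?D {x} = 0" for x
    unfolding D.isCont_cdf D.emeasure_eq_measure by simp
  interpret iid_continuous M X "{1..}" ?D
  proof unfold_locales
    show "distr M borel (X i) = ?D" if "i \<in> {1..}" for i
      using that by (intro assms(3)) simp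
  qed (rule assms(2) atomless | simp)+
  have k: "length \<sigma> = k"
    using length_finite_permutations_of_set[OF assms(5)] by simp
  have "contains_pattern \<sigma> \<sigma>"
    using st_Sym[OF assms(5)] by (auto simp: contains_pattern_def occurs_at_def intro!: exI[of _ 0])
  with assms(7) have ne: "\<sigma> \<noteq> \<tau>"
    by (auto simp: incomparable_def)
  define E where "E n = {\<omega> \<in> space M. first_hit \<sigma> \<tau> (map (\<lambda>i. X i \<omega>) [1..<Suc n])}" for n
  have E_st: "E n = {\<omega> \<in> space M. first_hit \<sigma> \<tau> (st (map (\<lambda>i. X i \<omega>) [1..<Suc n]))}" for n
    by (simp add: E_def first_hit_st del: upt_Suc)
  have idx: "distinct [1..<Suc n]" "set [1..<Suc n] \<subseteq> {1..}" for n
    by auto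
  have E_events: "range E \<subseteq> events"
    using st_in_events[OF idx(2), of "first_hit \<sigma> \<tau>"] unfolding E_st by blast
  have "disjoint_family E"
    unfolding disjoint_family_on_def E_def first_hit_prefix_iff_first_time[OF ne] by auto
  then have "(\<lambda>n. prob (E n)) sums prob (\<Union>n. E n)"
    by (rule finite_measure_UNION[OF E_events])
  also have "(\<Union>n. E n) = {\<omega> \<in> space M. first_time \<sigma> (\<lambda>i. X i \<omega>) < first_time \<tau> (\<lambda>i. X i \<omega>)}"
    unfolding E_def first_time_less_iff[OF ne] by blast
  also have "prob \<dots> = prob_before M X \<sigma> \<tau>"
    by (simp add: prob_before_def)
  finally have sum: "((\<lambda>n. prob (E n)) has_sum prob_before M X \<sigma> \<tau>) UNIV"
    by (rule sums_nonneg_imp_has_sum) simp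
  have prob_E: "prob (E n) = real (card (Av_end n \<sigma> \<tau>)) / fact n" for n
  proof -
    let ?xs = "\<lambda>\<omega>. map (\<lambda>i. X i \<omega>) [1..<Suc n]"
    have "AE \<omega> in M. distinct (?xs \<omega>)"
      by (rule AE_distinct[OF idx])
    then have "AE \<omega> in M. \<omega> \<in> E n \<longleftrightarrow> \<omega> \<in> {\<omega> \<in> space M. st (?xs \<omega>) \<in> Av_end n \<sigma> \<tau>}"
    proof eventually_elim
      case (elim \<omega>)
      then show ?case
        using st_in_Sym[OF elim]
        by (simp add: E_st Av_end_eq_first_hit del: upt_Suc One_nat_def)
    qed
    then have "prob (E n) = prob {\<omega> \<in> space M. st (?xs \<omega>) \<in> Av_end n \<sigma> \<tau>}"
      using E_events st_in_events[OF idx(2)] by (intro measure_eq_AE) auto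
    also have "\<dots> = real (card (Av_end n \<sigma> \<tau>)) / fact n"
      using prob_st_in[OF idx, of "Av_end n \<sigma> \<tau>"] by (auto simp: Av_end_def simp del: upt_Suc One_nat_def)
    finally show ?thesis .
  qed
  have "E n = {}" if "n < k" for n
    using that by (auto simp: E_def first_hit_def occurs_at_def k simp del: upt_Suc)
  then show ?thesis
    using sum prob_E by (subst has_sum_cong_neutral[where T = UNIV and g = "\<lambda>n. prob (E n)"]) auto
qed

end
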